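(* Let $f(x)=\frac1n\sum_{i=1}^nf_i(x)$ where each $f_i:\mathbb{R}^d\to\mathbb{R}$, $i=1,\ldots,n$, is differentiable, convex and symmetrically $(L_0,L_1)$-smooth with $L_0\ge0$, $L_1>0$, and suppose there exists $x^*\in\mathbb{R}^d$ such that $x^*\in\arg\min_{x\in\mathbb{R}^d}f_i(x)$ for all $i=1,\ldots,n$. Let $\nu$ be the real number with $\nu=e^{-\nu}$. Let $x^0\in\mathbb{R}^d$ and let $(x^k)_{k\ge0}$ be the iterates of Stochastic Gradient Descent with Polyak Stepsizes (SGD-PS): $$x^{k+1}=x^k-\frac{f_{\xi^k}(x^k)-f_{\xi^k}(x^* )}{\|\nabla f_{\xi^k}(x^k)\|^2}\nabla f_{\xi^k}(x^k),$$ where $\xi^k$ is sampled uniformly at random from $\{1,\ldots,n\}$, independently for each $k$. Then for every integer $N\ge0$ $$\min_{k=0,\ldots,N}\mathbb{E}\left[\min\left\{\frac{\nu L_0}{4nL_1^2},\ f(x^k)-f(x^* )\right\}\right]\le\frac{4L_0\|x^0-x^*\|^2}{\nu(N+1)}.$$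
   Context: $\|\cdot\|$ is the Euclidean norm. A differentiable $g:\mathbb{R}^d\to\mathbb{R}$ is convex if $g(y)\ge g(x)+\langle\nabla g(x),y-x\rangle$ for all $x,y$. It is symmetrically $(L_0,L_1)$-smooth if for all $x,y\in\mathbb{R}^d$ $$\|\nabla g(x)-\nabla g(y)\|\le\Big(L_0+L_1\sup_{u\in[x,y]}\|\nabla g(u)\|\Big)\|x-y\|,$$ where $[x,y]$ is the line segment between $x$ and $y$. Convention: if $\nabla f_{\xi^k}(x^k)=0$ (so $x^k$ minimizes $f_{\xi^k}$), then $x^{k+1}=x^k$. *)

theory Defs
  imports "HOL-Probability.Probability"
begin

text \<open>Meaningful where the function is differentiable, by
  uniqueness of the Riesz representation of the derivative (see \<open>gradient_GDERIV\<close> below).\<close>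

definition gradient :: "('a::real_inner \<Rightarrow> real) \<Rightarrow> 'a \<Rightarrow> 'a"
  where "gradient g x = (THE D. GDERIV g x :> D)"

lemma GDERIV_unique:
  assumes "GDERIV g x :> D" "GDERIV g x :> D'"
  shows "D = D'"
proof -
  have "(\<lambda>h. inner h D) = (\<lambda>h. inner h D')"
    using assms unfolding gderiv_def by (rule has_derivative_unique)
  then have "inner (D - D') D = inner (D - D') D'" by (rule fun_cong)
  then have "inner (D - D') (D - D') = 0" by (simp add: inner_diff_right)
  then show ?thesis by simp
qed

lemma gradient_eqI: "GDERIV g x :> D \<Longrightarrow> gradient g x = D"
  unfolding gradient_def by (blast intro: the_equality GDERIV_unique)

lemma gradient_GDERIV:
  fixes g :: "'a::euclidean_space \<Rightarrow> real"
  assumes "g differentiable (at x)"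
  shows "GDERIV g x :> gradient g x"
proof -
  obtain g' where g': "(g has_derivative g') (at x)"
    using assms unfolding differentiable_def by blast
  then have lin: "linear g'" by (rule has_derivative_linear)
  define D where "D = (\<Sum>b\<in>Basis. g' b *\<^sub>R b)"
  have "g' h = inner h D" for h
  proof -
    have "g' h = g' (\<Sum>b\<in>Basis. inner h b *\<^sub>R b)" by (simp add: euclidean_representation)
    also have "\<dots> = (\<Sum>b\<in>Basis. inner h b * g' b)"
      using lin by (simp add: linear_sum linear_scale)
    also have "\<dots> = inner h D" by (simp add: D_def inner_sum_right mult.commute)
    finally show ?thesis .
  qed
  then have "GDERIV g x :> D" using g' unfolding gderiv_def by (metis ext)
  then show ?thesis using gradient_eqI by metis
qed

definition grad_convex :: "('a::real_inner \<Rightarrow> real) \<Rightarrow> bool"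
  where "grad_convex g \<longleftrightarrow> (\<forall>x y. g y \<ge> g x + inner (gradient g x) (y - x))"

text \<open>For differentiable functions this is the library's convexity.\<close>

lemma grad_convex_iff_convex_on:
  fixes g :: "'a::euclidean_space \<Rightarrow> real"
  assumes diff: "\<And>x. g differentiable (at x)"
  shows "grad_convex g \<longleftrightarrow> convex_on UNIV g"
proof
  assume G: "grad_convex g"
  show "convex_on UNIV g"
  proof (rule convex_onI)
    fix t :: real and x y :: 'a
    assume t: "0 < t" "t < 1"
    define z where "z = (1 - t) *\<^sub>R x + t *\<^sub>R y"
    let ?p = "inner (gradient g z)"
    have "g x \<ge> g z + ?p (x - z)" "g y \<ge> g z + ?p (y - z)"
      using G unfolding grad_convex_def by blast+
    then have "(1 - t) * g x + t * g y \<ge> (1 - t) * (g z + ?p (x - z)) + t * (g z + ?p (y - z))"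
      using t by (intro add_mono mult_left_mono) auto
    moreover have "(1 - t) * (g z + ?p (x - z)) + t * (g z + ?p (y - z))
        = g z + ?p ((1 - t) *\<^sub>R (x - z) + t *\<^sub>R (y - z))"
      by (simp add: inner_add_right algebra_simps)
    moreover have "(1 - t) *\<^sub>R (x - z) + t *\<^sub>R (y - z) = 0"
      by (simp add: z_def algebra_simps)
    ultimately show "g ((1 - t) *\<^sub>R x + t *\<^sub>R y) \<le> (1 - t) * g x + t * g y"
      by (simp add: z_def)
  qed simp
next
  assume C: "convex_on UNIV g"
  show "grad_convex g"
    unfolding grad_convex_def
  proof (intro allI)
    fix x y :: 'a
    define h where "h t = g (x + t *\<^sub>R (y - x))" for t :: real
    have "convex_on UNIV h"
    proof (rule convex_onI)
      fix t a b :: real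
      assume t: "0 < t" "t < 1"
      have "x + ((1 - t) *\<^sub>R a + t *\<^sub>R b) *\<^sub>R (y - x)
          = (1 - t) *\<^sub>R (x + a *\<^sub>R (y - x)) + t *\<^sub>R (x + b *\<^sub>R (y - x))"
        by (simp add: algebra_simps)
      then show "h ((1 - t) *\<^sub>R a + t *\<^sub>R b) \<le> (1 - t) * h a + t * h b"
        unfolding h_def using convex_onD[OF C, of t] t by simp
    qed simp
    moreover have "(h has_real_derivative inner (gradient g x) (y - x)) (at 0)"
    proof -
      have "(g has_derivative (\<lambda>v. inner v (gradient g x))) (at (x + 0 *\<^sub>R (y - x)))"
        using gradient_GDERIV[OF diff, of x] by (simp add: gderiv_def)
      moreover have "((\<lambda>t. x + t *\<^sub>R (y - x)) has_derivative (\<lambda>t. t *\<^sub>R (y - x))) (at (0::real))"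
        by (auto intro!: derivative_eq_intros)
      ultimately have "(h has_derivative (\<lambda>t. inner (t *\<^sub>R (y - x)) (gradient g x))) (at 0)"
        using has_derivative_compose[of "\<lambda>t. x + t *\<^sub>R (y - x)" _ 0 UNIV g] unfolding h_def by blast
      then show ?thesis
        by (simp add: has_field_derivative_def inner_commute mult.commute
            lambda_one mult_commute_abs)
    qed
    ultimately have "h 1 - h 0 \<ge> inner (gradient g x) (y - x) * (1 - 0)"
      by (intro convex_on_imp_above_tangent[of UNIV]) auto
    then show "g y \<ge> g x + inner (gradient g x) (y - x)" by (simp add: h_def)
  qed
qed

text \<open>The supremum is taken in the extended reals, so that the bound is void if the gradient is
  unbounded on the segment.\<close>

definition sym_smooth :: "real \<Rightarrow> real \<Rightarrow> ('a::real_inner \<Rightarrow> real) \<Rightarrow> bool"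
  where "sym_smooth L0 L1 g \<longleftrightarrow>
    (\<forall>x y. ereal (norm (gradient g x - gradient g y))
      \<le> (ereal L0 + ereal L1 * (SUP u\<in>closed_segment x y. ereal (norm (gradient g u))))
          * ereal (norm (x - y)))"

definition polyak_step :: "('a::real_inner \<Rightarrow> real) \<Rightarrow> 'a \<Rightarrow> 'a \<Rightarrow> 'a"
  where "polyak_step g xstar x =
    (if gradient g x = 0 then x
     else x - ((g x - g xstar) / (norm (gradient g x))\<^sup>2) *\<^sub>R gradient g x)"

end

theory Submission
  imports Defs
begin

text \<open>Write \<open>p = \<nabla>g(x)\<close> and \<open>A = L0 + L1\<parallel>p\<parallel>\<close>. Along a segment of length \<open>r < 1/L1\<close> starting at
  \<open>x\<close>, the supremum \<open>S\<close> of the gradient norm is at most \<open>\<parallel>p\<parallel> + (L0 + L1 S) r\<close>, so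
  \<open>L0 + L1 S \<le> A / (1 - L1 r)\<close>. Integrating along \<open>x - t p\<close> up to \<open>t = 1/(2A)\<close> shows that \<open>g\<close> drops
  by at least \<open>(1 - ln 2) \<parallel>p\<parallel>\<^sup>2 / A\<close>. Since \<open>\<nu>/2 < 1 - ln 2\<close>, this bounds \<open>\<nu> \<parallel>p\<parallel>\<^sup>2 / (2A)\<close> by the
  optimality gap without any appeal to Gronwall's inequality. A Polyak step therefore
  decreases the squared distance to the minimizer by a multiple of the truncated gap of the
  sampled function. As \<open>x\<^sup>k\<close> is independent of \<open>\<xi>\<^sup>k\<close>, averaging over the sample gives the truncated gap
  of \<open>f\<close>, at the price of dividing the truncation level by \<open>n\<close>, and the bound telescopes.\<close>

section \<open>Gradient bounds for convex symmetrically smooth functions\<close>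

text \<open>A unit step along a nonzero gradient raises a convex function by at least the gradient
  norm, while a continuous function is bounded on a compact ball. This keeps the supremum in
  \<open>sym_smooth\<close> finite on every segment.\<close>

lemma grad_convex_gradient_bounded:
  fixes g :: "'a::euclidean_space \<Rightarrow> real"
  assumes diff: "\<And>x. g differentiable (at x)" and conv: "grad_convex g" and S: "bounded S"
  shows "bounded (gradient g ` S)"
proof -
  obtain R where R: "\<And>u. u \<in> S \<Longrightarrow> norm u \<le> R"
    using S unfolding bounded_iff by blast
  have "continuous_on (cball 0 (R + 1)) g"
    using diff by (simp add: differentiable_imp_continuous_on differentiable_at_withinI differentiable_on_def)
  then have "bounded (g ` cball 0 (R + 1))"
    by (simp add: compact_continuous_image compact_imp_bounded)
  then obtain B where B: "\<And>u. norm u \<le> R + 1 \<Longrightarrow> \<bar>g u\<bar> \<le> B"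
    unfolding bounded_iff by (metis imageI mem_cball_0 real_norm_def)
  have "norm (gradient g u) \<le> 2 * B" if u: "u \<in> S" for u
  proof -
    define h where "h = sgn (gradient g u)"
    have "norm h \<le> 1" by (simp add: h_def norm_sgn)
    then have "norm (u + h) \<le> R + 1" "norm u \<le> R + 1"
      using R[OF u] norm_triangle_ineq[of u h] by linarith+
    then have "\<bar>g (u + h)\<bar> \<le> B" "\<bar>g u\<bar> \<le> B" using B by blast+
    moreover have "g (u + h) \<ge> g u + inner (gradient g u) ((u + h) - u)"
      using conv unfolding grad_convex_def by blast
    moreover have "inner (gradient g u) h = norm (gradient g u)"
      by (cases "gradient g u = 0")
      (simp_all add: h_def sgn_div_norm power2_norm_eq_inner[symmetric] power2_eq_square)
    ultimately show ?thesis by simp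
  qed
  then show ?thesis unfolding bounded_iff by blast
qed

text \<open>Eliminates the supremum from \<open>sym_smooth\<close>, so that only the gradient at
  \<open>x\<close> remains. The supremum is bounded in terms of itself, and
  \<open>L1 * norm (y - x) < 1\<close> allows its share to be absorbed.\<close>

lemma sym_smooth_gradient_diff_le:
  fixes g :: "'a::euclidean_space \<Rightarrow> real"
  assumes diff: "\<And>x. g differentiable (at x)" and conv: "grad_convex g"
    and smooth: "sym_smooth L0 L1 g" and "L0 \<ge> 0" "L1 > 0"
    and r: "L1 * norm (y - x) < 1"
  shows "norm (gradient g y - gradient g x)
    \<le> (L0 + L1 * norm (gradient g x)) * norm (y - x) / (1 - L1 * norm (y - x))"
proof -
  define G where "G u = norm (gradient g u)" for u
  define S where "S = (SUP u\<in>closed_segment x y. G u)"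
  define r where "r = norm (y - x)"
  have "bounded (gradient g ` closed_segment x y)"
    by (rule grad_convex_gradient_bounded[OF diff conv bounded_closed_segment])
  then have bdd: "bdd_above (G ` closed_segment x y)"
    unfolding bounded_iff G_def bdd_above_def by auto
  \<comment> \<open>Smoothness is applied on the subsegments from \<open>x\<close> to
    \<open>u\<close>, so one \<open>S\<close> has to dominate all their suprema.\<close>
  have SUP_le: "(SUP v\<in>closed_segment x u. ereal (G v)) \<le> ereal S" if "u \<in> closed_segment x y" for u
  proof (rule SUP_least)
    fix v assume "v \<in> closed_segment x u"
    then have "v \<in> closed_segment x y"
      using that subset_closed_segment[of x u x y] by auto
    then show "ereal (G v) \<le> ereal S"
      unfolding S_def by (auto intro: cSUP_upper bdd)
  qed
  have S0: "S \<ge> 0"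
    using cSUP_upper[OF _ bdd, of x] unfolding S_def by (auto simp: G_def intro: order_trans[OF norm_ge_zero])
  have lip: "norm (gradient g u - gradient g x) \<le> (L0 + L1 * S) * norm (u - x)"
    if u: "u \<in> closed_segment x y" for u
  proof -
    have "ereal (norm (gradient g x - gradient g u))
      \<le> (ereal L0 + ereal L1 * (SUP v\<in>closed_segment x u. ereal (G v))) * ereal (norm (x - u))"
      using smooth unfolding sym_smooth_def G_def by blast
    also have "\<dots> \<le> (ereal L0 + ereal L1 * ereal S) * ereal (norm (x - u))"
      using \<open>L1 > 0\<close> SUP_le[OF u]
      by (intro ereal_mult_right_mono add_left_mono ereal_mult_left_mono) auto
    finally show ?thesis by (simp add: norm_minus_commute)
  qed
  have "S \<le> G x + (L0 + L1 * S) * r"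
    unfolding S_def
  proof (rule cSUP_least)
    fix u assume u: "u \<in> closed_segment x y"
    have "G u \<le> G x + norm (gradient g u - gradient g x)"
      unfolding G_def by (metis add.commute diff_add_cancel norm_triangle_ineq)
    also have "\<dots> \<le> G x + (L0 + L1 * S) * norm (u - x)" using lip[OF u] by simp
    also have "norm (u - x) \<le> r"
      using u segment_bound(1)[of u x y] by (simp add: r_def norm_minus_commute)
    then have "G x + (L0 + L1 * S) * norm (u - x) \<le> G x + (L0 + L1 * S) * r"
      using S0 \<open>L0 \<ge> 0\<close> \<open>L1 > 0\<close> by (intro add_left_mono mult_left_mono) auto
    finally show "G u \<le> G x + (L0 + L1 * (SUP u\<in>closed_segment x y. G u)) * r"
      by (simp add: S_def)
  qed auto
  \<comment> \<open>Scaling by \<open>L1\<close> and adding \<open>L0\<close> gives a closed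
    inequality for \<open>L0 + L1 * S\<close>.\<close>
  then have "L1 * S \<le> L1 * (G x + (L0 + L1 * S) * r)" using \<open>L1 > 0\<close> by simp
  then have "(L0 + L1 * S) * (1 - L1 * r) \<le> L0 + L1 * G x" by (simp add: algebra_simps)
  then have "L0 + L1 * S \<le> (L0 + L1 * G x) / (1 - L1 * r)"
    using r by (simp add: pos_le_divide_eq r_def)
  then have "(L0 + L1 * S) * r \<le> (L0 + L1 * G x) / (1 - L1 * r) * r"
    by (intro mult_right_mono) (auto simp: r_def)
  then show ?thesis using lip[of y] by (simp add: r_def G_def)
qed

text \<open>With \<open>p\<close> the gradient at \<open>x\<close>, the descent rate along the ray
  is at least \<open>(norm p)\<^sup>2 * (2 - 1 / (1 - t * A))\<close>. This bound reaches zero at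
  \<open>t = 1 / (2 * A)\<close>, whence the step length, and its integral up to there produces the
  factor \<open>1 - ln 2\<close>.\<close>

lemma sym_smooth_gradient_step_decrease:
  fixes g :: "'a::euclidean_space \<Rightarrow> real"
  assumes diff: "\<And>x. g differentiable (at x)" and conv: "grad_convex g"
    and smooth: "sym_smooth L0 L1 g" and "L0 \<ge> 0" "L1 > 0" and nz: "gradient g x \<noteq> 0"
    and A_def: "A = L0 + L1 * norm (gradient g x)"
  shows "g (x - (1 / (2 * A)) *\<^sub>R gradient g x)
    \<le> g x - (1 - ln 2) * (norm (gradient g x))\<^sup>2 / A"
proof -
  define p where "p = gradient g x"
  have A: "A > 0" using \<open>L0 \<ge> 0\<close> \<open>L1 > 0\<close> nz by (simp add: A_def add_nonneg_pos)
  \<comment> \<open>Adding the integrated lower bound on the descent rate to \<open>g\<close> along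
    the ray reduces the claim to \<open>\<psi>\<close> being nonincreasing.\<close>
  define \<psi> where "\<psi> t = g (x - t *\<^sub>R p) + (norm p)\<^sup>2 * (2 * t + ln (1 - t * A) / A)" for t
  have "\<psi> (1 / (2 * A)) \<le> \<psi> 0"
  proof (rule DERIV_nonpos_imp_nonincreasing[of _ _ \<psi>])
    show "0 \<le> 1 / (2 * A)" using A by simp
    fix t assume t: "0 \<le> t" "t \<le> 1 / (2 * A)"
    have tA: "t * A \<le> 1/2" using t A by (simp add: field_simps)
    let ?q = "gradient g (x - t *\<^sub>R p)"
    have "(g has_derivative (\<lambda>v. inner v ?q)) (at (x - t *\<^sub>R p))"
      using gradient_GDERIV[OF diff] by (simp add: gderiv_def)
    moreover have "((\<lambda>t. x - t *\<^sub>R p) has_derivative (\<lambda>s. - (s *\<^sub>R p))) (at t)"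
      by (auto intro!: derivative_eq_intros)
    ultimately have "((\<lambda>t. g (x - t *\<^sub>R p)) has_derivative (\<lambda>s. inner (- (s *\<^sub>R p)) ?q)) (at t)"
      using has_derivative_compose[of "\<lambda>t. x - t *\<^sub>R p" _ t UNIV g] by blast
    moreover have "(\<lambda>s. inner (- (s *\<^sub>R p)) ?q) = (*) (- inner p ?q)" by (simp add: fun_eq_iff)
    ultimately have 1: "((\<lambda>t. g (x - t *\<^sub>R p)) has_real_derivative - inner p ?q) (at t)"
      by (simp add: has_field_derivative_def)
    have 2: "((\<lambda>t. (norm p)\<^sup>2 * (2 * t + ln (1 - t * A) / A))
        has_real_derivative (norm p)\<^sup>2 * (2 - 1 / (1 - t * A))) (at t)"
      using tA A by (auto intro!: derivative_eq_intros simp: field_simps)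
    have D: "(\<psi> has_real_derivative - inner p ?q + (norm p)\<^sup>2 * (2 - 1 / (1 - t * A))) (at t)"
      unfolding \<psi>_def by (rule DERIV_add[OF 1 2])
    \<comment> \<open>This lets \<open>1 - t * A\<close>, which is at least 1/2 here, replace the
      denominator of the gradient bound, so that the rate depends on \<open>t * A\<close>
      alone.\<close>
    have "L1 * norm p \<le> A" using \<open>L0 \<ge> 0\<close> by (simp add: A_def p_def)
    then have le: "L1 * (t * norm p) \<le> t * A" using t(1) by (metis mult.left_commute mult_left_mono)
    have nrm: "norm ((x - t *\<^sub>R p) - x) = t * norm p" using t(1) by simp
    have "norm (?q - p) \<le> A * (t * norm p) / (1 - L1 * (t * norm p))"
      using sym_smooth_gradient_diff_le[OF diff conv smooth \<open>L0 \<ge> 0\<close> \<open>L1 > 0\<close>, of "x - t *\<^sub>R p" x]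
        le tA unfolding nrm by (simp add: A_def p_def)
    also have "\<dots> \<le> A * (t * norm p) / (1 - t * A)"
      using le tA A t by (intro divide_left_mono mult_pos_pos) auto
    finally have "norm p * norm (?q - p) \<le> norm p * (A * (t * norm p) / (1 - t * A))"
      by (rule mult_left_mono) simp
    moreover have "- inner p (?q - p) \<le> norm p * norm (?q - p)"
      using Cauchy_Schwarz_ineq2[of p "?q - p"] by linarith
    moreover have "inner p (?q - p) = inner p ?q - (norm p)\<^sup>2"
      by (simp add: inner_diff_right power2_norm_eq_inner)
    moreover have "norm p * (A * (t * norm p) / (1 - t * A)) = (norm p)\<^sup>2 * (1 / (1 - t * A) - 1)"
      using tA by (simp add: field_simps power2_eq_square)
    ultimately have "- inner p ?q + (norm p)\<^sup>2 * (2 - 1 / (1 - t * A)) \<le> 0"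
      unfolding right_diff_distrib by linarith
    then show "\<exists>y. (\<psi> has_real_derivative y) (at t) \<and> y \<le> 0" using D by blast
  qed
  then have "g (x - (1 / (2 * A)) *\<^sub>R p) + (norm p)\<^sup>2 * (1 / A + ln (1 / 2) / A) \<le> g x"
    using A by (simp add: \<psi>_def)
  moreover have "(norm p)\<^sup>2 * (1 / A + ln (1 / 2) / A) = (1 - ln 2) * (norm p)\<^sup>2 / A"
    by (simp add: ln_div algebra_simps diff_divide_distrib)
  ultimately show ?thesis by (simp add: p_def)
qed

text \<open>The solution \<open>\<nu>\<close> is the omega constant, about 0.567, so
  \<open>\<nu> / 2\<close> lies just below \<open>1 - ln 2\<close>, about 0.307.\<close>

lemma omega_constant_bounds:
  fixes \<nu> :: real
  assumes nu: "\<nu> = exp (- \<nu>)"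
  shows "0 < \<nu>" "\<nu> / 2 \<le> 1 - ln 2"
proof -
  show pos: "0 < \<nu>" using nu exp_gt_zero by metis
  \<comment> \<open>The value 61/100 is below \<open>2 * (1 - 25/36)\<close>, as needed with
    \<open>ln 2 \<le> 25/36\<close>, and large enough that \<open>61/100 * 1.79 > 1\<close>
    contradicts \<open>\<nu> * exp \<nu> = 1\<close>.\<close>
  have "\<nu> \<le> 61 / 100"
  proof (rule ccontr)
    assume "\<not> ?thesis"
    then have n: "\<nu> > 61/100" by simp
    have "exp \<nu> \<ge> 1 + \<nu>" by (rule exp_ge_add_one_self)
    have "\<nu>\<^sup>2 \<ge> (61/100)\<^sup>2" using n by (intro power_mono) auto
    then have "exp \<nu> \<ge> 1.79"
      using n exp_lower_Taylor_quadratic[of \<nu>] pos by (simp add: power2_eq_square)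
    then have "\<nu> * exp \<nu> \<ge> 61/100 * 1.79" using n by (intro mult_mono) auto
    moreover have "\<nu> * exp \<nu> = 1" by (subst nu) (simp add: exp_minus)
    ultimately show False by simp
  qed
  then show "\<nu> / 2 \<le> 1 - ln 2" using ln2_le_25_over_36 by simp
qed

text \<open>The value after the gradient step is still no less than the minimum, so the guaranteed
  decrease cannot exceed the optimality gap.\<close>

lemma sym_smooth_gradient_norm_le:
  fixes g :: "'a::euclidean_space \<Rightarrow> real"
  assumes diff: "\<And>x. g differentiable (at x)" and conv: "grad_convex g"
    and smooth: "sym_smooth L0 L1 g" and "L0 \<ge> 0" "L1 > 0"
    and nu: "\<nu> = exp (- \<nu>)" and min: "\<And>y. g xstar \<le> g y"
  shows "\<nu> * (norm (gradient g x))\<^sup>2 \<le> 2 * (L0 + L1 * norm (gradient g x)) * (g x - g xstar)"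
proof (cases "gradient g x = 0")
  case True
  then show ?thesis using \<open>L0 \<ge> 0\<close> min[of x] by simp
next
  case False
  define A where "A = L0 + L1 * norm (gradient g x)"
  have A: "A > 0" using \<open>L0 \<ge> 0\<close> \<open>L1 > 0\<close> False by (simp add: A_def add_nonneg_pos)
  have "(1 - ln 2) * (norm (gradient g x))\<^sup>2 / A \<le> g x - g xstar"
    using sym_smooth_gradient_step_decrease[OF diff conv smooth \<open>L0 \<ge> 0\<close> \<open>L1 > 0\<close> False A_def]
      min order_trans by (smt (verit))
  then have "(1 - ln 2) * (norm (gradient g x))\<^sup>2 \<le> A * (g x - g xstar)"
    using A by (simp add: field_simps)
  moreover have "\<nu> / 2 * (norm (gradient g x))\<^sup>2 \<le> (1 - ln 2) * (norm (gradient g x))\<^sup>2"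
    using omega_constant_bounds(2)[OF nu] by (intro mult_right_mono) auto
  ultimately have "\<nu> * (norm (gradient g x))\<^sup>2 \<le> 2 * (A * (g x - g xstar))" by linarith
  then show ?thesis by (simp only: A_def mult.assoc)
qed

section \<open>Progress of a single Polyak step\<close>

text \<open>By convexity, a step of length \<open>c \<ge> 0\<close> along the negative gradient
  \<open>p\<close> changes the squared distance by at most
  \<open>c\<^sup>2 * (norm p)\<^sup>2 - 2 * c * D\<close>, with \<open>D\<close> the gap. The Polyak
  stepsize minimizes this quadratic.\<close>

lemma polyak_step_dist_le:
  fixes g :: "'a::euclidean_space \<Rightarrow> real"
  assumes conv: "grad_convex g" and min: "\<And>y. g xstar \<le> g y"
  shows "(norm (polyak_step g xstar x - xstar))\<^sup>2
    \<le> (norm (x - xstar))\<^sup>2 - (g x - g xstar)\<^sup>2 / (norm (gradient g x))\<^sup>2"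
proof (cases "gradient g x = 0")
  \<comment> \<open>The point stays put and division by zero yields zero, so the claim is an
    equality.\<close>
  case True
  then show ?thesis by (simp add: polyak_step_def)
next
  case False
  define p where "p = gradient g x"
  define D where "D = g x - g xstar"
  define c where "c = D / (norm p)\<^sup>2"
  have p: "(norm p)\<^sup>2 > 0" using False by (simp add: p_def)
  have c: "c \<ge> 0" using min[of x] by (simp add: c_def D_def)
  have "g xstar \<ge> g x + inner p (xstar - x)"
    using conv unfolding grad_convex_def p_def by blast
  then have "D \<le> inner p (x - xstar)" by (simp add: D_def inner_diff_right)
  then have "c * D \<le> c * inner p (x - xstar)" using c by (rule mult_left_mono)
  moreover have "(norm (polyak_step g xstar x - xstar))\<^sup>2
      = (norm ((x - xstar) - c *\<^sub>R p))\<^sup>2"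
    using False by (simp add: polyak_step_def c_def D_def p_def algebra_simps)
  moreover have "\<dots> = (norm (x - xstar))\<^sup>2 - 2 * (c * inner p (x - xstar)) + c\<^sup>2 * (norm p)\<^sup>2"
    unfolding power2_norm_eq_inner
    by (simp add: inner_diff_left inner_diff_right inner_commute algebra_simps power2_eq_square)
  moreover have "c\<^sup>2 * (norm p)\<^sup>2 = D\<^sup>2 / (norm p)\<^sup>2" "c * D = D\<^sup>2 / (norm p)\<^sup>2"
    using p by (simp_all add: c_def power2_eq_square)
  ultimately show ?thesis by (simp add: p_def D_def)
qed

text \<open>The two arguments of \<open>min\<close> correspond to the regimes \<open>L0 < L1 * norm (gradient g x)\<close>
  and \<open>L1 * norm (gradient g x) \<le> L0\<close>.\<close>

lemma polyak_step_decrease: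
  fixes g :: "'a::euclidean_space \<Rightarrow> real"
  assumes diff: "\<And>x. g differentiable (at x)" and conv: "grad_convex g"
    and smooth: "sym_smooth L0 L1 g" and "L0 > 0" "L1 > 0"
    and nu: "\<nu> = exp (- \<nu>)" and min: "\<And>y. g xstar \<le> g y"
  shows "\<nu> / (4 * L0) * min (\<nu> * L0 / (4 * L1\<^sup>2)) (g x - g xstar)
    \<le> (norm (x - xstar))\<^sup>2 - (norm (polyak_step g xstar x - xstar))\<^sup>2"
proof -
  define p where "p = norm (gradient g x)"
  define D where "D = g x - g xstar"
  have nu0: "\<nu> > 0" by (rule omega_constant_bounds[OF nu])
  have D0: "D \<ge> 0" using min by (simp add: D_def)
  have key: "\<nu> * p\<^sup>2 \<le> 2 * (L0 + L1 * p) * D"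
    using sym_smooth_gradient_norm_le[OF diff conv smooth _ \<open>L1 > 0\<close> nu min, of x] \<open>L0 > 0\<close>
    by (simp add: p_def D_def)
  have "\<nu> / (4 * L0) * min (\<nu> * L0 / (4 * L1\<^sup>2)) D \<le> D\<^sup>2 / p\<^sup>2"
  proof (cases "p = 0")
    case True
    have "g xstar \<ge> g x + inner (gradient g x) (xstar - x)"
      using conv unfolding grad_convex_def by blast
    then have "D \<le> 0" using True by (simp add: p_def D_def)
    then have "min (\<nu> * L0 / (4 * L1\<^sup>2)) D = 0" using D0 nu0 \<open>L0 > 0\<close> by simp
    then show ?thesis by simp
  next
    case False
    then have p: "p > 0" by (simp add: p_def)
    show ?thesis
    proof (cases "L1 * p \<le> L0")
      case True
      have "2 * (L0 + L1 * p) * D \<le> 4 * L0 * D" using True D0 by (intro mult_right_mono) auto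
      then have "\<nu> * p\<^sup>2 \<le> 4 * L0 * D" using key by linarith
      then have "\<nu> * p\<^sup>2 * D \<le> 4 * L0 * D * D" using D0 by (rule mult_right_mono)
      then have "\<nu> / (4 * L0) * D \<le> D\<^sup>2 / p\<^sup>2"
        using p \<open>L0 > 0\<close> by (simp add: field_simps power2_eq_square)
      moreover have "\<nu> / (4 * L0) * min (\<nu> * L0 / (4 * L1\<^sup>2)) D \<le> \<nu> / (4 * L0) * D"
        using nu0 \<open>L0 > 0\<close> by (intro mult_left_mono) auto
      ultimately show ?thesis by linarith
    next
      case False
      \<comment> \<open>In this regime the gap is at least a multiple of the gradient norm, so
        \<open>D / p\<close> is bounded below by a constant. The truncation level is the one for
        which the square of that constant matches the left-hand side.\<close>
      have "2 * (L0 + L1 * p) * D \<le> 4 * (L1 * p) * D" using False D0 by (intro mult_right_mono) auto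
      then have "p * (\<nu> * p) \<le> p * (4 * L1 * D)" using key by (simp add: power2_eq_square algebra_simps)
      then have "\<nu> * p \<le> 4 * L1 * D" using p by simp
      then have "\<nu> / (4 * L1) \<le> D / p" using p \<open>L1 > 0\<close> by (simp add: field_simps)
      then have "(\<nu> / (4 * L1))\<^sup>2 \<le> (D / p)\<^sup>2" using nu0 \<open>L1 > 0\<close> by (intro power_mono) auto
      moreover have "\<nu> / (4 * L0) * min (\<nu> * L0 / (4 * L1\<^sup>2)) D \<le> \<nu> / (4 * L0) * (\<nu> * L0 / (4 * L1\<^sup>2))"
        using nu0 \<open>L0 > 0\<close> by (intro mult_left_mono) auto
      moreover have "\<nu> / (4 * L0) * (\<nu> * L0 / (4 * L1\<^sup>2)) = (\<nu> / (4 * L1))\<^sup>2"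
        using \<open>L0 > 0\<close> by (simp add: power2_eq_square)
      ultimately show ?thesis by (simp add: power_divide)
    qed
  qed
  then show ?thesis
    using polyak_step_dist_le[OF conv min, of x] by (simp add: p_def D_def)
qed

section \<open>Averaging over an independent uniform sample\<close>

text \<open>Either some term reaches the level \<open>c\<close>, and it alone contributes
  \<open>c / card I\<close> to the average, or the truncation changes nothing.\<close>

lemma min_average_le:
  fixes a :: "'i \<Rightarrow> real"
  assumes I: "finite I" "I \<noteq> {}" and c: "c \<ge> 0" and a: "\<And>i. i \<in> I \<Longrightarrow> a i \<ge> 0"
  shows "min (c / card I) ((\<Sum>i\<in>I. a i) / card I) \<le> (\<Sum>i\<in>I. min c (a i)) / card I"
proof (cases "\<exists>i\<in>I. a i \<ge> c")
  case True
  then obtain i where i: "i \<in> I" "a i \<ge> c" by blast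
  have "min c (a i) \<le> (\<Sum>i\<in>I. min c (a i))"
    using i I c a by (intro member_le_sum) auto
  then have "c / card I \<le> (\<Sum>i\<in>I. min c (a i)) / card I"
    using i by (intro divide_right_mono) auto
  then show ?thesis by linarith
next
  case False
  then have "(\<Sum>i\<in>I. min c (a i)) = (\<Sum>i\<in>I. a i)" by (intro sum.cong) auto
  then show ?thesis by simp
qed

text \<open>\<open>y k\<close> reads only the samples with index below \<open>k\<close>, hence is
  independent of \<open>\<xi> k\<close>. As the samples take countably many values, the state space
  can carry the discrete sigma-algebra and \<open>step\<close> can be any map.\<close>

lemma (in prob_space) indep_var_recursion:
  fixes \<xi> :: "nat \<Rightarrow> 'a \<Rightarrow> 'i::countable" and y :: "nat \<Rightarrow> 'a \<Rightarrow> 'b"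
  assumes indep: "indep_vars (\<lambda>_. count_space UNIV) \<xi> UNIV"
    and y0: "\<And>\<omega>. y 0 \<omega> = y0" and ySuc: "\<And>k \<omega>. y (Suc k) \<omega> = step (\<xi> k \<omega>) (y k \<omega>)"
  shows "y k \<in> measurable M (count_space UNIV)"
    and "indep_var borel (\<lambda>\<omega>. p (\<xi> k \<omega>) :: real) borel (\<lambda>\<omega>. q (y k \<omega>) :: real)"
proof -
  define G where "G k v = rec_nat y0 (\<lambda>j. step (v j)) k" for k and v :: "nat \<Rightarrow> 'i"
  let ?C = "\<lambda>_. count_space UNIV :: 'i measure"
  have G: "G k \<in> measurable (PiM J ?C) (count_space UNIV)" if "{..<k} \<subseteq> J" for k J
    using that
  proof (induction k)
    case 0
    then show ?case by (simp add: G_def)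
  next
    case (Suc k)
    have IH: "G k \<in> measurable (PiM J ?C) (count_space UNIV)" using Suc.IH Suc.prems by (simp add: lessThan_Suc)
    have "(\<lambda>v. step (v k) (G k v)) \<in> measurable (PiM J ?C) (count_space UNIV)"
    proof (rule measurable_compose_countable[where f="\<lambda>i v. step i (G k v)" and g="\<lambda>v. v k"])
      show "(\<lambda>v. step i (G k v)) \<in> measurable (PiM J ?C) (count_space UNIV)" for i
        by (rule measurable_compose[OF IH]) simp
      show "(\<lambda>v. v k) \<in> measurable (PiM J ?C) (count_space UNIV)"
        using Suc.prems by (intro measurable_component_singleton) auto
    qed
    then show ?case by (simp add: G_def)
  qed
  \<comment> \<open>The restricted sequence is \<open>undefined\<close> outside
    \<open>{..<m}\<close>, but the recursion up to \<open>k \<le> m\<close> never reads those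
    entries. A separate \<open>m\<close> keeps the index set fixed during the induction.\<close>
  have Gy: "G k (\<lambda>i\<in>{..<m}. \<xi> i \<omega>) = y k \<omega>" if "k \<le> m" for k m \<omega>
    using that by (induction k) (auto simp: G_def y0 ySuc)
  have "indep_var (PiM {k} ?C) (\<lambda>\<omega>. restrict (\<lambda>i. \<xi> i \<omega>) {k})
      (PiM {..<k} ?C) (\<lambda>\<omega>. restrict (\<lambda>i. \<xi> i \<omega>) {..<k})"
    by (rule indep_var_restrict[OF indep]) auto
  then have "indep_var borel ((\<lambda>v. p (v k)) \<circ> (\<lambda>\<omega>. restrict (\<lambda>i. \<xi> i \<omega>) {k}))
      borel ((\<lambda>v. q (G k v)) \<circ> (\<lambda>\<omega>. restrict (\<lambda>i. \<xi> i \<omega>) {..<k}))"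
  proof (rule indep_var_compose)
    show "(\<lambda>v. p (v k)) \<in> borel_measurable (PiM {k} ?C)"
      by (rule measurable_compose[OF measurable_component_singleton]) auto
    show "(\<lambda>v. q (G k v)) \<in> borel_measurable (PiM {..<k} ?C)"
      by (rule measurable_compose[OF G]) auto
  qed
  then show "indep_var borel (\<lambda>\<omega>. p (\<xi> k \<omega>)) borel (\<lambda>\<omega>. q (y k \<omega>))"
    by (simp add: o_def Gy)
  have "(\<lambda>\<omega>. \<lambda>i\<in>{..<k}. \<xi> i \<omega>) \<in> measurable M (PiM {..<k} ?C)"
    using indep by (intro measurable_restrict) (auto simp: indep_vars_def)
  from measurable_compose[OF this G] show "y k \<in> measurable M (count_space UNIV)"
    by (simp add: Gy)
qed

text \<open>Independence is phrased through real-valued functions of \<open>\<xi>\<close> and \<open>Y\<close> because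
  \<open>indep_var\<close> forces both random variables to have the same type.\<close>

lemma (in prob_space) expectation_uniform_indep:
  fixes \<xi> :: "'a \<Rightarrow> 'i::countable" and Y :: "'a \<Rightarrow> 'b" and \<phi> :: "'i \<Rightarrow> 'b \<Rightarrow> real"
  assumes \<xi>[measurable]: "\<xi> \<in> measurable M (count_space UNIV)"
    and Y: "Y \<in> measurable M (count_space UNIV)"
    and indep: "\<And>(p :: 'i \<Rightarrow> real) (q :: 'b \<Rightarrow> real).
      indep_var borel (\<lambda>\<omega>. p (\<xi> \<omega>)) borel (\<lambda>\<omega>. q (Y \<omega>))"
    and I: "finite I" "I \<noteq> {}"
    and uniform: "distr M (count_space UNIV) \<xi> = measure_pmf (pmf_of_set I)"
    and int: "\<And>i. i \<in> I \<Longrightarrow> integrable M (\<lambda>\<omega>. \<phi> i (Y \<omega>))"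
  shows "integrable M (\<lambda>\<omega>. \<phi> (\<xi> \<omega>) (Y \<omega>))"
    and "expectation (\<lambda>\<omega>. \<phi> (\<xi> \<omega>) (Y \<omega>)) = (\<Sum>i\<in>I. expectation (\<lambda>\<omega>. \<phi> i (Y \<omega>))) / card I"
proof -
  have "AE i in distr M (count_space UNIV) \<xi>. i \<in> I"
    unfolding uniform using I by (simp add: AE_measure_pmf_iff)
  then have AE: "AE \<omega> in M. \<xi> \<omega> \<in> I" by (simp add: AE_distr_iff)
  have m: "(\<lambda>\<omega>. \<phi> (\<xi> \<omega>) (Y \<omega>)) \<in> borel_measurable M"
    by (rule measurable_compose_countable[OF measurable_compose[OF Y] \<xi>]) simp
  \<comment> \<open>Splitting by the value of the sample gives products of a function of
    \<open>\<xi>\<close> and a function of \<open>Y\<close>, whose expectations factor by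
    independence.\<close>
  let ?p = "\<lambda>i \<omega>. indicator {i} (\<xi> \<omega>) * \<phi> i (Y \<omega>)"
  have eq: "AE \<omega> in M. \<phi> (\<xi> \<omega>) (Y \<omega>) = (\<Sum>i\<in>I. ?p i \<omega>)"
    using AE
  proof eventually_elim
    case (elim \<omega>)
    then have "(\<Sum>i\<in>I. ?p i \<omega>) = (\<Sum>i\<in>I. if i = \<xi> \<omega> then \<phi> i (Y \<omega>) else 0)"
      by (intro sum.cong) (auto simp: indicator_def)
    then show ?case using elim I by simp
  qed
  have ind_int: "integrable M (\<lambda>\<omega>. indicator {i} (\<xi> \<omega>) :: real)" for i
    by (rule integrable_const_bound[where B=1]) (auto simp: indicator_def)
  have p_int: "integrable M (?p i)" if "i \<in> I" for i
    by (rule indep_var_integrable[OF indep ind_int int[OF that]])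
  have prb: "expectation (\<lambda>\<omega>. indicator {i} (\<xi> \<omega>) :: real) = 1 / card I" if "i \<in> I" for i
  proof -
    have "expectation (\<lambda>\<omega>. indicator {i} (\<xi> \<omega>) :: real)
        = integral\<^sup>L (distr M (count_space UNIV) \<xi>) (indicator {i})"
      by (subst integral_distr) auto
    then show ?thesis unfolding uniform using I that by (simp add: measure_pmf_single)
  qed
  have p_exp: "expectation (?p i) = expectation (\<lambda>\<omega>. \<phi> i (Y \<omega>)) / card I" if "i \<in> I" for i
    using indep_var_lebesgue_integral[OF indep ind_int int[OF that]] prb[OF that] by simp
  have sum_int: "integrable M (\<lambda>\<omega>. \<Sum>i\<in>I. ?p i \<omega>)" using p_int by simp
  then show "integrable M (\<lambda>\<omega>. \<phi> (\<xi> \<omega>) (Y \<omega>))"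
    using integrable_cong_AE[OF m _ eq] borel_measurable_integrable by blast
  have "expectation (\<lambda>\<omega>. \<phi> (\<xi> \<omega>) (Y \<omega>)) = expectation (\<lambda>\<omega>. \<Sum>i\<in>I. ?p i \<omega>)"
    by (rule integral_cong_AE[OF m _ eq]) (use sum_int in auto)
  also have "\<dots> = (\<Sum>i\<in>I. expectation (?p i))" by (rule Bochner_Integration.integral_sum) (rule p_int)
  also have "\<dots> = (\<Sum>i\<in>I. expectation (\<lambda>\<omega>. \<phi> i (Y \<omega>)) / card I)"
    by (rule sum.cong) (auto simp: p_exp)
  finally show "expectation (\<lambda>\<omega>. \<phi> (\<xi> \<omega>) (Y \<omega>)) = (\<Sum>i\<in>I. expectation (\<lambda>\<omega>. \<phi> i (Y \<omega>))) / card I"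
    by (simp add: sum_divide_distrib)
qed

section \<open>Convergence rate of SGD with Polyak stepsizes\<close>

theorem theorem7p3:
  fixes n :: nat
    and fi :: "nat \<Rightarrow> real ^ 'd \<Rightarrow> real"
    and f :: "real ^ 'd \<Rightarrow> real"
    and L0 L1 \<nu> :: real
    and x0 xstar :: "real ^ 'd"
    and M :: "'w measure"
    and \<xi> :: "nat \<Rightarrow> 'w \<Rightarrow> nat"
    and x :: "nat \<Rightarrow> 'w \<Rightarrow> real ^ 'd"
    and N :: nat
  assumes "n \<ge> 1"
    and f_avg: "\<And>z. f z = 1 / real n * (\<Sum>i=1..n. fi i z)"
    and diff: "\<And>i z. i \<in> {1..n} \<Longrightarrow> fi i differentiable (at z)"
    and conv: "\<And>i. i \<in> {1..n} \<Longrightarrow> grad_convex (fi i)"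
    and smooth: "\<And>i. i \<in> {1..n} \<Longrightarrow> sym_smooth L0 L1 (fi i)"
    and "L0 \<ge> 0" and "L1 > 0"
    and minimizer: "\<And>i. i \<in> {1..n} \<Longrightarrow> is_arg_min (fi i) (\<lambda>_. True) xstar"
    and nu: "\<nu> = exp (- \<nu>)"
    and "prob_space M"
    and indep: "prob_space.indep_vars M (\<lambda>_. count_space UNIV) \<xi> UNIV"
    and uniform: "\<And>k. distr M (count_space UNIV) (\<xi> k) = measure_pmf (pmf_of_set {1..n})"
    and x_0: "\<And>\<omega>. \<omega> \<in> space M \<Longrightarrow> x 0 \<omega> = x0"
    and x_Suc: "\<And>k \<omega>. \<omega> \<in> space M \<Longrightarrow>
      x (Suc k) \<omega> = polyak_step (fi (\<xi> k \<omega>)) xstar (x k \<omega>)"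
  shows "(MIN k\<in>{0..N}. prob_space.expectation M
            (\<lambda>\<omega>. min (\<nu> * L0 / (4 * real n * L1\<^sup>2)) (f (x k \<omega>) - f xstar)))
         \<le> 4 * L0 * (norm (x0 - xstar))\<^sup>2 / (\<nu> * (real N + 1))"
proof -
  interpret prob_space M by fact
  let ?c = "\<nu> * L0 / (4 * L1\<^sup>2)"
  let ?cn = "\<nu> * L0 / (4 * real n * L1\<^sup>2)"
  have nu0: "\<nu> > 0" by (rule omega_constant_bounds[OF nu])
  have c0: "?c \<ge> 0" using nu0 \<open>L0 \<ge> 0\<close> by simp
  have cn: "?cn = ?c / card {1..n}" by simp
  define \<Delta> where "\<Delta> i z = fi i z - fi i xstar" for i z
  have min: "fi i xstar \<le> fi i z" if "i \<in> {1..n}" for i z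
    using minimizer[OF that] by (auto simp: is_arg_min_linorder)
  then have \<Delta>0: "\<Delta> i z \<ge> 0" if "i \<in> {1..n}" for i z using that by (simp add: \<Delta>_def)
  have f\<Delta>: "f z - f xstar = (\<Sum>i\<in>{1..n}. \<Delta> i z) / card {1..n}" for z
    by (simp add: f_avg \<Delta>_def sum_subtractf diff_divide_distrib)
  have f0: "f z - f xstar \<ge> 0" for z
    unfolding f\<Delta> by (intro divide_nonneg_nonneg sum_nonneg \<Delta>0) auto
  define h where "h z = min ?cn (f z - f xstar)" for z
  \<comment> \<open>\<open>y\<close> agrees with \<open>x\<close> on \<open>space M\<close> but
    satisfies the recursion for every \<open>\<omega>\<close>, as \<open>indep_var_recursion\<close>
    requires.\<close>
  define y where "y k \<omega> = rec_nat x0 (\<lambda>j. polyak_step (fi (\<xi> j \<omega>)) xstar) k" for k \<omega>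
  have xy: "x k \<omega> = y k \<omega>" if "\<omega> \<in> space M" for k \<omega>
    by (induction k) (simp_all add: y_def x_0 x_Suc that)
  define e where "e k = expectation (\<lambda>\<omega>. h (y k \<omega>))" for k
  have goal_e: "expectation (\<lambda>\<omega>. min ?cn (f (x k \<omega>) - f xstar)) = e k" for k
    unfolding e_def h_def by (rule Bochner_Integration.integral_cong) (simp_all add: xy)
  have "(MIN k\<in>{0..N}. e k) \<le> 4 * L0 * (norm (x0 - xstar))\<^sup>2 / (\<nu> * (real N + 1))"
  \<comment> \<open>For \<open>L0 = 0\<close> the truncation level is zero and both sides vanish.
    The other case divides by \<open>L0\<close>.\<close>
  proof (cases "L0 = 0")
    case True
    have "h z = 0" for z using f0[of z] by (simp add: h_def True)
    then have "e k = 0" for k by (simp add: e_def)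
    then show ?thesis by (simp add: True)
  next
    case False
    with \<open>L0 \<ge> 0\<close> have L0: "L0 > 0" by simp
    define a where "a = \<nu> / (4 * L0)"
    have a: "a > 0" using nu0 L0 by (simp add: a_def)
    define \<psi> where "\<psi> i z = min ?c (\<Delta> i z)" for i z
    have \<psi>0: "\<psi> i z \<ge> 0" if "i \<in> {1..n}" for i z using \<Delta>0[OF that] c0 by (simp add: \<psi>_def)
    define V where "V z = (norm (z - xstar))\<^sup>2" for z
    have step: "a * \<psi> i z \<le> V z - V (polyak_step (fi i) xstar z)" if i: "i \<in> {1..n}" for i z
      using polyak_step_decrease[OF diff[OF i] conv[OF i] smooth[OF i] L0 \<open>L1 > 0\<close> nu min[OF i]]
      by (simp add: a_def \<psi>_def \<Delta>_def V_def)
    have \<xi>_meas: "\<xi> k \<in> measurable M (count_space UNIV)" for k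
      using indep by (simp add: indep_vars_def)
    have y_0: "y 0 \<omega> = x0"
      and y_Suc: "y (Suc k) \<omega> = polyak_step (fi (\<xi> k \<omega>)) xstar (y k \<omega>)" for k \<omega>
      by (simp_all add: y_def)
    note rec = indep_var_recursion[where step="\<lambda>i. polyak_step (fi i) xstar", OF indep y_0 y_Suc]
    have y_meas: "(\<lambda>\<omega>. q (y k \<omega>)) \<in> borel_measurable M" for k and q :: "real ^ 'd \<Rightarrow> real"
      by (rule measurable_compose[OF rec(1)]) simp
    \<comment> \<open>Nothing is known about \<open>fi i\<close> for \<open>i\<close> outside
      \<open>{1..n}\<close>, so the pathwise estimates hold only off a null set.\<close>
    have "AE i in distr M (count_space UNIV) (\<xi> k). i \<in> {1..n}" for k
      unfolding uniform using \<open>n \<ge> 1\<close> by (simp add: AE_measure_pmf_iff)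
    then have "AE \<omega> in M. \<xi> k \<omega> \<in> {1..n}" for k
      by (simp add: AE_distr_iff \<xi>_meas)
    then have AE\<xi>: "AE \<omega> in M. \<forall>k. \<xi> k \<omega> \<in> {1..n}" by (simp only: AE_all_countable) blast
    have Vstep: "a * \<psi> (\<xi> k \<omega>) (y k \<omega>) \<le> V (y k \<omega>) - V (y (Suc k) \<omega>)"
      if "\<forall>k. \<xi> k \<omega> \<in> {1..n}" for k \<omega>
      using step[of "\<xi> k \<omega>" "y k \<omega>"] that by (simp add: y_def)
    \<comment> \<open>The distance to the minimizer never grows along such a path. The resulting
      bound makes \<open>V (y k \<omega>)\<close> integrable.\<close>
    have V_le: "V (y k \<omega>) \<le> V x0" if w: "\<forall>k. \<xi> k \<omega> \<in> {1..n}" for k \<omega>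
    proof (induction k)
      case (Suc k)
      have "a * \<psi> (\<xi> k \<omega>) (y k \<omega>) \<ge> 0" using a \<psi>0[of "\<xi> k \<omega>"] w by simp
      then show ?case using Vstep[OF w, of k] Suc by linarith
    qed (simp add: y_def)
    have V_int: "integrable M (\<lambda>\<omega>. V (y k \<omega>))" for k
    proof (rule integrable_const_bound[where B="V x0"])
      show "AE \<omega> in M. norm (V (y k \<omega>)) \<le> V x0"
        using AE\<xi> by eventually_elim (use V_le in \<open>simp add: V_def\<close>)
    qed (rule y_meas)
    have \<psi>_int: "integrable M (\<lambda>\<omega>. \<psi> i (y k \<omega>))" if i: "i \<in> {1..n}" for i k
    proof (rule integrable_const_bound[where B="?c"])
      show "AE \<omega> in M. norm (\<psi> i (y k \<omega>)) \<le> ?c" using \<psi>0[OF i] by (simp add: \<psi>_def)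
    qed (rule y_meas)
    have h_int: "integrable M (\<lambda>\<omega>. h (y k \<omega>))" for k
    proof (rule integrable_const_bound[where B="?cn"])
      have "0 \<le> h z" for z 
        unfolding h_def using f0[of z] nu0 L0 by simp
      then show "AE \<omega> in M. norm (h (y k \<omega>)) \<le> ?cn" by (simp add: h_def)
    qed (rule y_meas)
    \<comment> \<open>This is where the truncation level drops from \<open>?c\<close> to
      \<open>?c / n\<close>.\<close>
    have h_le: "h z \<le> (\<Sum>i\<in>{1..n}. \<psi> i z) / card {1..n}" for z
      unfolding h_def cn f\<Delta> \<psi>_def using \<open>n \<ge> 1\<close> c0 \<Delta>0 by (intro min_average_le) auto
    have dec: "a * e k \<le> expectation (\<lambda>\<omega>. V (y k \<omega>)) - expectation (\<lambda>\<omega>. V (y (Suc k) \<omega>))" for k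
    proof -
      have ne: "{1..n} \<noteq> {}" using \<open>n \<ge> 1\<close> by simp
      note unif = expectation_uniform_indep[where \<phi>=\<psi>,
          OF \<xi>_meas[of k] rec(1)[of k] rec(2)[of _ k] finite_atLeastAtMost ne uniform]
      have \<psi>\<xi>_int: "integrable M (\<lambda>\<omega>. \<psi> (\<xi> k \<omega>) (y k \<omega>))"
        by (rule unif(1)[OF \<psi>_int])
      have "e k \<le> expectation (\<lambda>\<omega>. (\<Sum>i\<in>{1..n}. \<psi> i (y k \<omega>)) / card {1..n})"
        unfolding e_def
        by (intro integral_mono h_int h_le integrable_divide Bochner_Integration.integrable_sum \<psi>_int)
      also have "\<dots> = (\<Sum>i\<in>{1..n}. expectation (\<lambda>\<omega>. \<psi> i (y k \<omega>))) / card {1..n}"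
        by (simp only: integral_divide_zero Bochner_Integration.integral_sum[OF \<psi>_int])
      also have "\<dots> = expectation (\<lambda>\<omega>. \<psi> (\<xi> k \<omega>) (y k \<omega>))"
        by (rule unif(2)[OF \<psi>_int, symmetric])
      finally have "a * e k \<le> expectation (\<lambda>\<omega>. a * \<psi> (\<xi> k \<omega>) (y k \<omega>))"
        using a by simp
      also have "\<dots> \<le> expectation (\<lambda>\<omega>. V (y k \<omega>) - V (y (Suc k) \<omega>))"
      proof (rule integral_mono_AE)
        show "AE \<omega> in M. a * \<psi> (\<xi> k \<omega>) (y k \<omega>) \<le> V (y k \<omega>) - V (y (Suc k) \<omega>)"
          using AE\<xi> by eventually_elim (rule Vstep)
      qed (use \<psi>\<xi>_int V_int in auto)
      also have "\<dots> = expectation (\<lambda>\<omega>. V (y k \<omega>)) - expectation (\<lambda>\<omega>. V (y (Suc k) \<omega>))"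
        by (rule Bochner_Integration.integral_diff[OF V_int V_int])
      finally show ?thesis .
    qed
    define m where "m = (MIN k\<in>{0..N}. e k)"
    \<comment> \<open>The minimum is at most each of the \<open>Suc N\<close> terms with
      \<open>k = 0, ..., N\<close>, so the telescoping sum bounds \<open>N + 1\<close> copies of
      it.\<close>
    have "(real N + 1) * m = (\<Sum>k<Suc N. m)" by simp
    also have "\<dots> \<le> (\<Sum>k<Suc N. e k)" unfolding m_def by (intro sum_mono Min_le) auto
    finally have "a * ((real N + 1) * m) \<le> (\<Sum>k<Suc N. a * e k)"
      using a by (simp add: sum_distrib_left[symmetric])
    also have "\<dots> \<le> (\<Sum>k<Suc N. expectation (\<lambda>\<omega>. V (y k \<omega>)) - expectation (\<lambda>\<omega>. V (y (Suc k) \<omega>)))"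
      by (intro sum_mono dec)
    also have "\<dots> = expectation (\<lambda>\<omega>. V (y 0 \<omega>)) - expectation (\<lambda>\<omega>. V (y (Suc N) \<omega>))"
      by (rule sum_lessThan_telescope')
    also have "expectation (\<lambda>\<omega>. V (y 0 \<omega>)) = V x0" by (simp add: y_def prob_space)
    also have "V x0 - expectation (\<lambda>\<omega>. V (y (Suc N) \<omega>)) \<le> V x0" by (simp add: V_def)
    finally have "\<nu> / (4 * L0) * ((real N + 1) * m) \<le> (norm (x0 - xstar))\<^sup>2"
      by (simp add: a_def V_def)
    then have "m * (\<nu> * (real N + 1)) \<le> 4 * L0 * (norm (x0 - xstar))\<^sup>2"
      using L0 by (simp add: pos_divide_le_eq mult_ac)
    then show ?thesis
      unfolding m_def[symmetric] using nu0 by (subst pos_le_divide_eq) auto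
  qed
  then show ?thesis by (simp only: goal_e)
qed

end
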